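(* Let $\rho>1$ be a real number and let $u_\rho=\lceil\rho(\rho-1)\rceil$. A set $A\subseteq\mathbb{N}$ is strongly complete if it satisfies (i) $|A\cap(\rho^k,\rho^{k+1}]|\ge u_\rho+1+1_{\rho>2}$ for all sufficiently large $k$; (ii) $\gcd(A\cap[N,\infty))=1$ for every $N\in\mathbb{N}$; (iii) writing $A=\{a_1<a_2<\cdots\}$, $$\liminf_{n\to\infty}(a_{n+1}-a_n)<\infty.$$
   Context: $\mathbb{N}=\{1,2,3,\ldots\}$. $1_{\rho>2}$ equals $1$ if $\rho>2$ and $0$ otherwise. For $S\subseteq\mathbb{Z}$ containing a nonzero element, $\gcd(S)$ is the largest $d\in\mathbb{N}$ dividing every element of $S$. A set $A\subseteq\mathbb{N}$ is complete if every sufficiently large positive integer is a sum of distinct elements of $A$, and strongly complete if $A\setminus B$ is complete for every finite subset $B\subseteq A$. *)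

theory Defs
  imports Complex_Main "HOL-Library.Infinite_Set" "HOL-Library.Extended_Real"
begin

text \<open>
  Completeness in the sense of subset sums. Sets of positive integers are modelled as sets of
  naturals not containing 0.
\<close>

definition sum_complete :: "nat set \<Rightarrow> bool" where
  "sum_complete A \<longleftrightarrow>
     (\<forall>\<^sub>F n in sequentially. \<exists>F. finite F \<and> F \<subseteq> A \<and> n = \<Sum>F)"

definition strongly_sum_complete :: "nat set \<Rightarrow> bool" where
  "strongly_sum_complete A \<longleftrightarrow> (\<forall>B. finite B \<and> B \<subseteq> A \<longrightarrow> sum_complete (A - B))"

definition u_rho :: "real \<Rightarrow> int" where
  "u_rho \<rho> = \<lceil>\<rho> * (\<rho> - 1)\<rceil>"

end

theory Submission
  imports Defs
begin

text \<open>
  Two elements \<open>b\<close> and \<open>b + d\<close> of \<open>A\<close> offer a choice that shifts a subset sum by \<open>d\<close>, and \<open>K\<close>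
  disjoint such pairs offer an arithmetic progression of \<open>K + 1\<close> sums with difference \<open>d\<close>. The
  bounded lower limit of the gaps yields one \<open>d\<close> with infinitely many pairs. The gcd condition
  yields a finite \<open>F \<subseteq> A\<close> whose subset sums meet every residue class modulo \<open>d\<close>. If what
  remains of \<open>A\<close> after the removal of \<open>F\<close> and of the pairs still has subset sums with gaps at most
  \<open>G\<close>, then every large \<open>n\<close> is reached: go below \<open>n\<close> by a bounded amount with a subset sum of the
  remainder, correct the residue modulo \<open>d\<close> with \<open>F\<close>, and fill the remaining multiple of \<open>d\<close>
  from the progression, provided that \<open>K\<close> is large in terms of \<open>G\<close> and \<open>F\<close>.

  The difficulty is that \<open>K\<close> depends on \<open>G\<close>, so that the gaps must not grow with the number of
  removed pairs. The gaps are at most \<open>G\<close> as soon as each element \<open>c\<close> is at most \<open>G\<close> plus the sum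
  of all smaller elements. The property \<open>pair_robust\<close> says that this domination holds
  with an arbitrarily large margin for large \<open>c\<close>, even after two arbitrary elements are dropped. It
  survives finite removals, which makes the pairs removable one by one at no cost
  (\<open>remove_pairs\<close>) and also makes completeness strong.

  Robustness is what the density condition provides (\<open>dense_blocks_imp_pair_robust\<close>). With \<open>r\<close>
  elements in each block \<open>(\<rho>^j, \<rho>^(j+1)]\<close>, the elements up to \<open>\<rho>^(m+1)\<close> sum to about
  \<open>r \<rho>^(m+1) / (\<rho> - 1)\<close>, of which \<open>\<rho> (\<rho> - 1)\<close> elements per block pay for the next \<open>c \<le> \<rho>^(m+2)\<close>.
  The loss of two elements is essentially at most \<open>2 \<rho>^m\<close>, and the surplus elements pay for it: one
  per block gives \<open>\<rho>^(m+1) / (\<rho> - 1)\<close>, which exceeds \<open>2 \<rho>^m\<close> exactly when \<open>\<rho> < 2\<close>; two per block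
  suffice for every \<open>\<rho>\<close>. At \<open>\<rho> = 2\<close> the leading terms cancel, and the margin comes from
  integrality: an element above \<open>2^j\<close> is at least \<open>2^j + 1\<close>, and these units add up to an
  unbounded surplus.
\<close>

section \<open>Subset sums and their gaps\<close>

definition subset_sums :: "nat set \<Rightarrow> nat set" where
  "subset_sums A = {\<Sum>F | F. finite F \<and> F \<subseteq> A}"

lemma subset_sumsI: "finite F \<Longrightarrow> F \<subseteq> A \<Longrightarrow> \<Sum>F \<in> subset_sums A"
  by (auto simp: subset_sums_def)

lemma subset_sumsE:
  assumes "s \<in> subset_sums A"
  obtains F where "finite F" "F \<subseteq> A" "s = \<Sum>F"
  using assms by (auto simp: subset_sums_def)

lemma zero_in_subset_sums: "0 \<in> subset_sums A"
  using subset_sumsI[of "{}" A] by simp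

lemma subset_sums_mono: "A \<subseteq> B \<Longrightarrow> subset_sums A \<subseteq> subset_sums B"
  by (auto simp: subset_sums_def)

lemma subset_sums_add:
  assumes "s \<in> subset_sums A" "t \<in> subset_sums B" "A \<inter> B = {}"
  shows "s + t \<in> subset_sums (A \<union> B)"
proof -
  obtain F where F: "finite F" "F \<subseteq> A" "s = \<Sum>F" using assms(1) by (rule subset_sumsE)
  obtain H where H: "finite H" "H \<subseteq> B" "t = \<Sum>H" using assms(2) by (rule subset_sumsE)
  have "F \<inter> H = {}" using F H assms(3) by blast
  then have "s + t = \<Sum>(F \<union> H)" using F H by (simp add: sum.union_disjoint)
  then show ?thesis using F H subset_sumsI[of "F \<union> H" "A \<union> B"] by auto
qed

lemma sum_complete_iff_subset_sums:
  "sum_complete A \<longleftrightarrow> (\<forall>\<^sub>F n in sequentially. n \<in> subset_sums A)"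
  by (auto simp: sum_complete_def subset_sums_def intro!: arg_cong2[where f=eventually])

text \<open>
  Greedy argument: a target that is out of reach of the elements below \<^term>\<open>N\<close> exceeds
  \<^term>\<open>N\<close> by the domination hypothesis, so \<^term>\<open>N\<close> can be used and the rest of the target is in
  reach again.
\<close>

lemma bounded_gaps_below:
  assumes step: "\<And>c. c \<in> A \<Longrightarrow> c \<le> \<Sum>{a\<in>A. a < c} + G"
    and "n \<le> \<Sum>{a\<in>A. a < N} + G"
  shows "\<exists>s\<in>subset_sums {a\<in>A. a < N}. s \<le> n \<and> n \<le> s + G"
  using assms(2)
proof (induction N arbitrary: n)
  case 0
  then show ?case by (auto intro!: bexI[of _ 0] zero_in_subset_sums)
next
  case (Suc N)
  have mono: "subset_sums {a\<in>A. a < N} \<subseteq> subset_sums {a\<in>A. a < Suc N}"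
    by (rule subset_sums_mono) auto
  show ?case
  proof (cases "n \<le> \<Sum>{a\<in>A. a < N} + G")
    case True
    then show ?thesis using Suc.IH mono by blast
  next
    case False
    have "N \<in> A"
    proof (rule ccontr)
      assume "N \<notin> A"
      then have "{a\<in>A. a < Suc N} = {a\<in>A. a < N}" by (auto simp: less_Suc_eq)
      then show False using False Suc.prems by simp
    qed
    then have split: "{a\<in>A. a < Suc N} = {a\<in>A. a < N} \<union> {N}" by auto
    have "n \<le> \<Sum>{a\<in>A. a < N} + N + G"
      using Suc.prems unfolding split by (subst (asm) sum.union_disjoint) auto
    moreover have "N \<le> n" using False step[OF \<open>N \<in> A\<close>] by linarith
    ultimately obtain s where s: "s \<in> subset_sums {a\<in>A. a < N}" "s \<le> n - N" "n - N \<le> s + G"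
      using Suc.IH[of "n - N"] by force
    have "s + N \<in> subset_sums {a\<in>A. a < Suc N}"
      unfolding split by (rule subset_sums_add[OF s(1)]) (use subset_sumsI[of "{N}"] in auto)
    then show ?thesis using s \<open>N \<le> n\<close> by (intro bexI[of _ "s + N"]) auto
  qed
qed

lemma bounded_gaps:
  assumes "\<And>c. c \<in> A \<Longrightarrow> c \<le> \<Sum>{a\<in>A. a < c} + G" and "infinite A"
  shows "\<exists>s\<in>subset_sums A. s \<le> n \<and> n \<le> s + G"
proof -
  obtain b where b: "b \<in> A" "n < b" using assms(2) by (meson infinite_nat_iff_unbounded)
  have "b \<le> \<Sum>{a\<in>A. a < Suc b}" by (rule member_le_sum) (use b in auto)
  then have "\<exists>s\<in>subset_sums {a\<in>A. a < Suc b}. s \<le> n \<and> n \<le> s + G"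
    using b by (intro bounded_gaps_below[OF assms(1)]) auto
  moreover have "subset_sums {a\<in>A. a < Suc b} \<subseteq> subset_sums A"
    by (rule subset_sums_mono) auto
  ultimately show ?thesis by blast
qed

section \<open>Domination that survives the removal of pairs\<close>

text \<open>
  Two dropped elements are allowed because elements are later removed in pairs; the order of
  quantifiers makes the threshold uniform in the pair, so that a pair can be chosen after it.
\<close>

definition pair_robust :: "nat set \<Rightarrow> bool" where
  "pair_robust A \<longleftrightarrow> (\<forall>D. \<exists>N. \<forall>c\<ge>N. \<forall>x y. c + D \<le> \<Sum>{a \<in> A - {x, y}. a < c})"

lemma pair_robust_Diff_finite:
  assumes "pair_robust A" "finite E"
  shows "pair_robust (A - E)"
  unfolding pair_robust_def
proof
  fix D
  obtain N where N: "\<And>c x y. c \<ge> N \<Longrightarrow> c + (D + \<Sum>E) \<le> \<Sum>{a \<in> A - {x, y}. a < c}"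
    using assms(1) unfolding pair_robust_def by metis
  have "c + D \<le> \<Sum>{a \<in> A - E - {x, y}. a < c}" if "c \<ge> N" for c x y
  proof -
    have "\<Sum>{a \<in> A - {x, y}. a < c} \<le> \<Sum>({a \<in> A - E - {x, y}. a < c} \<union> E)"
      by (rule sum_mono2) (use assms(2) in auto)
    also have "\<dots> \<le> \<Sum>{a \<in> A - E - {x, y}. a < c} + \<Sum>E"
      using assms(2) by (subst sum.union_disjoint) auto
    finally show ?thesis using N[OF that, of x y] by linarith
  qed
  then show "\<exists>N. \<forall>c\<ge>N. \<forall>x y. c + D \<le> \<Sum>{a \<in> A - E - {x, y}. a < c}" by blast
qed

lemma pair_robust_imp_infinite:
  assumes "pair_robust A"
  shows "infinite A"
proof
  assume "finite A"
  then have "pair_robust (A - A)" using assms by (rule pair_robust_Diff_finite[rotated])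
  then obtain N where "\<And>c x y. c \<ge> N \<Longrightarrow> c + 1 \<le> \<Sum>{a \<in> A - A - {x, y}. a < c}"
    unfolding pair_robust_def by metis
  from this[of N] show False by simp
qed

lemma pair_robust_imp_step:
  assumes "pair_robust A"
  obtains G where "\<And>c. c \<in> A \<Longrightarrow> c \<le> \<Sum>{a \<in> A. a < c} + G"
proof -
  obtain N where N: "\<And>c x y. c \<ge> N \<Longrightarrow> c + 0 \<le> \<Sum>{a \<in> A - {x, y}. a < c}"
    using assms unfolding pair_robust_def by metis
  show thesis
  proof
    fix c assume "c \<in> A"
    show "c \<le> \<Sum>{a \<in> A. a < c} + N"
    proof (cases "c \<ge> N")
      case True
      have "\<Sum>{a \<in> A - {c, c}. a < c} \<le> \<Sum>{a \<in> A. a < c}" by (rule sum_mono2) auto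
      then show ?thesis using N[OF True, of c c] by linarith
    qed simp
  qed
qed

lemma infinite_pairs_Diff_finite:
  fixes A :: "nat set"
  assumes "infinite {b \<in> A. b + d \<in> A}" "finite E"
  shows "infinite {b \<in> A - E. b + d \<in> A - E}"
proof -
  have "{b \<in> A. b + d \<in> A} \<subseteq> {b \<in> A - E. b + d \<in> A - E} \<union> E \<union> {b. b + d \<in> E}" by auto
  moreover have "finite {b. b + d \<in> E}"
    using finite_vimageI[OF assms(2), of "\<lambda>b. b + d"] by (simp add: vimage_def)
  ultimately show ?thesis
    using assms by (metis (no_types, lifting) finite_Un finite_subset)
qed

text \<open>
  The constant \<^term>\<open>G\<close> does not depend on \<^term>\<open>K\<close>, which matters because the number of pairs is
  later chosen in terms of \<^term>\<open>G\<close>. It can be kept because each new pair is taken beyond the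
  threshold \<^term>\<open>N\<close> of robustness with margin \<^term>\<open>0::nat\<close>: elements below \<^term>\<open>N\<close> do not see
  the removal at all, and elements above it keep their domination. Choosing one member from
  each of the \<^term>\<open>K\<close> removed pairs gives the arithmetic progression.
\<close>

lemma remove_pairs:
  assumes rob: "pair_robust A"
    and pairs: "infinite {b \<in> A. b + d \<in> A}"
    and step: "\<And>c. c \<in> A \<Longrightarrow> c \<le> \<Sum>{a \<in> A. a < c} + G"
  shows "\<exists>P s. finite P \<and> P \<subseteq> A \<and> (\<forall>j\<le>K. s + j * d \<in> subset_sums P) \<and>
               (\<forall>c\<in>A - P. c \<le> \<Sum>{a \<in> A - P. a < c} + G)"
proof (induction K)
  case 0
  show ?case
    by (rule exI[of _ "{}"], rule exI[of _ 0]) (use step zero_in_subset_sums in auto)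
next
  case (Suc K)
  then obtain P s where P: "finite P" "P \<subseteq> A" "\<And>j. j \<le> K \<Longrightarrow> s + j * d \<in> subset_sums P"
    "\<And>c. c \<in> A - P \<Longrightarrow> c \<le> \<Sum>{a \<in> A - P. a < c} + G"
    by blast
  obtain N where N: "\<And>c x y. c \<ge> N \<Longrightarrow> c + 0 \<le> \<Sum>{a \<in> A - P - {x, y}. a < c}"
    using pair_robust_Diff_finite[OF rob P(1)] unfolding pair_robust_def by metis
  obtain b where b: "b \<in> A" "b + d \<in> A" "b > N + \<Sum>P"
    using pairs unfolding infinite_nat_iff_unbounded by blast
  have notin: "b \<notin> P" "b + d \<notin> P"
    using b(3) member_le_sum[OF _ _ P(1), of _ "\<lambda>x. x"] by fastforce+
  let ?P = "P \<union> {b, b + d}"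
  have sub: "x \<in> {b, b + d} \<Longrightarrow> s' \<in> subset_sums P \<Longrightarrow> s' + x \<in> subset_sums ?P" for x s'
    using subset_sums_add[of s' P x "{b, b + d}"] subset_sumsI[of "{x}" "{b, b + d}"] notin by auto
  have AP: "(s + b) + j * d \<in> subset_sums ?P" if "j \<le> Suc K" for j
  proof (cases "j \<le> K")
    case True
    then have "s + j * d + b \<in> subset_sums ?P" by (intro sub P(3)) auto
    then show ?thesis by (simp add: ac_simps)
  next
    case False
    then have j: "j = Suc K" using that by simp
    have "s + K * d + (b + d) \<in> subset_sums ?P" by (intro sub P(3)) auto
    then show ?thesis by (simp add: j ac_simps)
  qed
  have "c \<le> \<Sum>{a \<in> A - ?P. a < c} + G" if c: "c \<in> A - ?P" for c
  proof (cases "c \<ge> N")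
    case True
    have "A - ?P = A - P - {b, b + d}" by auto
    then show ?thesis using N[OF True, of b "b + d"] by simp
  next
    case False
    then have "{a \<in> A - ?P. a < c} = {a \<in> A - P. a < c}" using b(3) by auto
    then show ?thesis using P(4)[of c] c by simp
  qed
  moreover have "finite ?P" "?P \<subseteq> A" using P b by auto
  ultimately show ?case using AP by blast
qed

section \<open>Residues of subset sums\<close>

text \<open>
  A submonoid of the naturals that is periodic with period \<^term>\<open>d\<close> is closed under subtraction
  modulo \<^term>\<open>d\<close>, so it behaves like a subgroup of the integers: its least positive element
  divides all others.
\<close>

lemma one_in_periodic_semigroup:
  fixes H :: "nat set"
  assumes add: "\<And>h k. h \<in> H \<Longrightarrow> k \<in> H \<Longrightarrow> h + k \<in> H"
    and period: "\<And>h q. h + q * d \<in> H \<longleftrightarrow> h \<in> H"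
    and "d > 0" "0 \<in> H" "Gcd H = 1"
  shows "1 \<in> H"
proof -
  define g where "g = (LEAST h. h \<in> H \<and> h > 0)"
  have "d \<in> H" using period[of 0 1] \<open>0 \<in> H\<close> by simp
  then have g: "g \<in> H" "g > 0"
    using LeastI[of "\<lambda>h. h \<in> H \<and> h > 0" d] \<open>d > 0\<close> by (auto simp: g_def)
  have mult: "q * g \<in> H" for q
    by (induction q) (use \<open>0 \<in> H\<close> add g in auto)
  have "g dvd h" if "h \<in> H" for h
  proof -
    \<comment> \<open>Adding \<^term>\<open>(d - 1) * g\<close> amounts to subtracting \<^term>\<open>g\<close> modulo \<^term>\<open>d\<close>.\<close>
    define q where "q = h div g"
    obtain e where e: "d = Suc e" using \<open>d > 0\<close> by (cases d) auto
    have "h + (q * e) * g = (h mod g + q * g) + (q * e) * g" by (simp add: q_def)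
    also have "\<dots> = h mod g + (q * g) * d" by (simp add: e algebra_simps)
    finally have "h mod g \<in> H" using add[OF that mult[of "q * e"]] period by simp
    moreover have "h mod g < g" using g by simp
    ultimately have "h mod g = 0"
      unfolding g_def using not_less_Least[of "h mod g" "\<lambda>h. h \<in> H \<and> h > 0"] g_def by auto
    then show ?thesis by auto
  qed
  then have "g dvd Gcd H" by (rule Gcd_greatest)
  then show ?thesis using \<open>Gcd H = 1\<close> g by simp
qed

text \<open>
  All but finitely many elements of \<^term>\<open>A\<close> lie in residue classes that \<^term>\<open>A\<close> meets
  infinitely often. Adding such a residue never leaves the set \<^term>\<open>Z\<close> of residues of subset sums,
  since a fresh element with this residue is always available. The shifts that preserve \<^term>\<open>Z\<close>
  therefore contain a tail of \<^term>\<open>A\<close>, and so have gcd 1.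
\<close>

lemma finite_subset_sums_all_residues:
  fixes A :: "nat set"
  assumes gcd: "\<And>N. N \<ge> 1 \<Longrightarrow> Gcd (A \<inter> {N..}) = 1" and "d > 0"
  obtains F where "finite F" "F \<subseteq> A" "\<And>r. \<exists>s\<in>subset_sums F. s mod d = r mod d"
proof -
  define Z where "Z = (\<lambda>s. s mod d) ` subset_sums A"
  define H where "H = {h. \<forall>z\<in>Z. (z + h) mod d \<in> Z}"
  \<comment> \<open>The exceptional elements, whose residue class need not provide fresh representatives.\<close>
  define S where "S = {a \<in> A. finite {x \<in> A. x mod d = a mod d}}"
  have "S \<subseteq> (\<Union>r\<in>{r. r < d \<and> finite {x \<in> A. x mod d = r}}. {x \<in> A. x mod d = r})"
    using \<open>d > 0\<close> by (auto simp: S_def)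
  then have "finite S" by (rule finite_subset) auto
  then obtain N where N: "\<And>a. a \<in> S \<Longrightarrow> a < N" by (auto simp: finite_nat_set_iff_bounded)
  have A_H: "a \<in> H" if a: "a \<in> A" "a \<ge> N" for a
    unfolding H_def
  proof (intro CollectI ballI)
    fix z assume "z \<in> Z"
    then obtain F where F: "finite F" "F \<subseteq> A" "z = (\<Sum>F) mod d"
      by (auto simp: Z_def elim: subset_sumsE)
    have "infinite {x \<in> A. x mod d = a mod d}" using N[of a] a by (auto simp: S_def)
    then have "infinite ({x \<in> A. x mod d = a mod d} - F)" using F(1) by simp
    then obtain x where x: "x \<in> A" "x mod d = a mod d" "x \<notin> F" 
      using infinite_imp_nonempty by blast
    have "\<Sum>(insert x F) \<in> subset_sums A" by (rule subset_sumsI) (use F x in auto)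
    moreover have "(\<Sum>(insert x F)) mod d = (z + a) mod d"
      using F x by (simp add: mod_simps) (metis add.commute mod_add_left_eq)
    ultimately show "(z + a) mod d \<in> Z" unfolding Z_def by (metis imageI)
  qed
  have "1 \<in> H"
  proof (rule one_in_periodic_semigroup)
    show "h + k \<in> H" if "h \<in> H" "k \<in> H" for h k
    proof -
      have "((z + h) mod d + k) mod d \<in> Z" if "z \<in> Z" for z
        using \<open>h \<in> H\<close> \<open>k \<in> H\<close> that by (auto simp: H_def)
      then show ?thesis by (auto simp: H_def mod_simps add.assoc)
    qed
    show "h + q * d \<in> H \<longleftrightarrow> h \<in> H" for h q
      by (simp add: H_def flip: add.assoc)
    show "0 \<in> H" by (auto simp: H_def Z_def)
    have "Gcd H dvd Gcd (A \<inter> {max N 1..})"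
      by (rule Gcd_greatest) (auto intro!: Gcd_dvd A_H)
    then show "Gcd H = 1" using gcd[of "max N 1"] by simp
  qed (fact \<open>d > 0\<close>)
  then have Suc_Z: "Suc z mod d \<in> Z" if "z \<in> Z" for z using that by (auto simp: H_def)
  have "r mod d \<in> Z" for r
  proof (induction r)
    case 0
    then show ?case using zero_in_subset_sums by (force simp: Z_def)
  next
    case (Suc r)
    then show ?case using Suc_Z[of "r mod d"] by (simp add: mod_simps)
  qed
  then have "\<exists>F. finite F \<and> F \<subseteq> A \<and> r mod d = (\<Sum>F) mod d" for r
    unfolding Z_def by (metis (no_types, lifting) imageE subset_sumsE)
  then obtain f where f: "\<And>r. finite (f r)" "\<And>r. f r \<subseteq> A" "\<And>r. r mod d = (\<Sum>(f r)) mod d"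
    by metis
  show thesis
  proof
    show "finite (\<Union>r<d. f r)" "(\<Union>r<d. f r) \<subseteq> A" using f by auto
    fix r
    have "\<Sum>(f (r mod d)) \<in> subset_sums (\<Union>r<d. f r)"
      by (rule subset_sumsI) (use f(1,2) \<open>d > 0\<close> in \<open>auto intro!: bexI[of _ "r mod d"]\<close>)
    moreover have "(\<Sum>(f (r mod d))) mod d = r mod d" using f(3)[of "r mod d"] by simp
    ultimately show "\<exists>s\<in>subset_sums (\<Union>r<d. f r). s mod d = r mod d" by blast
  qed
qed

section \<open>Completeness of robust sets\<close>

lemma pair_robust_imp_sum_complete:
  assumes rob: "pair_robust A"
    and pairs: "infinite {b \<in> A. b + d \<in> A}" and "d > 0"
    and gcd: "\<And>N. N \<ge> 1 \<Longrightarrow> Gcd (A \<inter> {N..}) = 1"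
  shows "sum_complete A"
proof -
  obtain F where F: "finite F" "F \<subseteq> A" "\<And>r. \<exists>s\<in>subset_sums F. s mod d = r mod d"
    using finite_subset_sums_all_residues[OF gcd \<open>d > 0\<close>] by blast
  let ?A = "A - F"
  have rob': "pair_robust ?A" using rob F(1) by (rule pair_robust_Diff_finite)
  have pairs': "infinite {b \<in> ?A. b + d \<in> ?A}"
    using pairs F(1) by (rule infinite_pairs_Diff_finite)
  obtain G where G: "\<And>c. c \<in> ?A \<Longrightarrow> c \<le> \<Sum>{a \<in> ?A. a < c} + G"
    using pair_robust_imp_step[OF rob'] by blast
  define M where "M = \<Sum>F"
  \<comment> \<open>The progression has to bridge the gap \<^term>\<open>G\<close> and the uncertainty \<^term>\<open>M\<close> of the residue
    correction.\<close>
  obtain P s where P: "finite P" "P \<subseteq> ?A"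
    and AP: "\<And>j. j \<le> M + G \<Longrightarrow> s + j * d \<in> subset_sums P"
    and step: "\<And>c. c \<in> ?A - P \<Longrightarrow> c \<le> \<Sum>{a \<in> ?A - P. a < c} + G"
    using remove_pairs[OF rob' pairs' G, of "M + G"] by blast
  have inf: "infinite (?A - P)" using pair_robust_imp_infinite[OF rob'] P(1) by simp
  have "n \<in> subset_sums A" if n: "n \<ge> s + M" for n
  proof -
    obtain t where t: "t \<in> subset_sums (?A - P)" "t \<le> n - s - M" "n - s - M \<le> t + G"
      using bounded_gaps[OF step inf] by blast
    obtain f where f: "f \<in> subset_sums F" "f mod d = (n - s - t) mod d" using F(3) by blast
    have "f \<le> M" using f(1) unfolding M_def
      by (elim subset_sumsE) (auto intro!: sum_mono2 F(1))
    then have "f \<le> n - s - t" using t n by linarith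
    then obtain j where j: "n - s - t = f + j * d"
      using f(2) by (metis mod_eq_nat1E mult.commute)
    have "j \<le> j * d" using \<open>d > 0\<close> by simp
    also have "\<dots> \<le> M + G" using j t n by linarith
    finally have "s + j * d \<in> subset_sums P" by (rule AP)
    then have "f + (s + j * d) \<in> subset_sums (F \<union> P)"
      using subset_sums_add[OF f(1)] P(2) by blast
    then have "t + (f + (s + j * d)) \<in> subset_sums (?A - P \<union> (F \<union> P))"
      using subset_sums_add[OF t(1)] by blast
    moreover have "t + (f + (s + j * d)) = n" using j t n by linarith
    moreover have "?A - P \<union> (F \<union> P) = A" using F P by blast
    ultimately show ?thesis by simp
  qed
  then show ?thesis
    unfolding sum_complete_iff_subset_sums eventually_sequentially by blast
qed

theorem pair_robust_imp_strongly_sum_complete: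
  assumes rob: "pair_robust A"
    and pairs: "infinite {b \<in> A. b + d \<in> A}" and "d > 0"
    and gcd: "\<And>N. N \<ge> 1 \<Longrightarrow> Gcd (A \<inter> {N..}) = 1"
  shows "strongly_sum_complete A"
  unfolding strongly_sum_complete_def
proof (intro allI impI, elim conjE)
  fix B assume B: "finite B" "B \<subseteq> A"
  show "sum_complete (A - B)"
  proof (rule pair_robust_imp_sum_complete)
    show "pair_robust (A - B)" using rob B(1) by (rule pair_robust_Diff_finite)
    show "infinite {b \<in> A - B. b + d \<in> A - B}"
      using pairs B(1) by (rule infinite_pairs_Diff_finite)
    show "d > 0" by fact
    show "Gcd ((A - B) \<inter> {N..}) = 1" if "N \<ge> 1" for N
    proof -
      obtain N' where N': "\<And>b. b \<in> B \<Longrightarrow> b < N'"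
        using B(1) by (auto simp: finite_nat_set_iff_bounded)
      have "A \<inter> {max N N'..} \<subseteq> (A - B) \<inter> {N..}" using N' by fastforce
      then have "Gcd ((A - B) \<inter> {N..}) dvd Gcd (A \<inter> {max N N'..})"
        by (intro Gcd_greatest Gcd_dvd) blast
      then show ?thesis using gcd[of "max N N'"] that by simp
    qed
  qed
qed

section \<open>Pairs from a bounded lower limit of gaps\<close>

text \<open>
  Infinitely many gaps lie below a fixed bound, so one value is taken infinitely often.
\<close>

lemma liminf_gap_imp_infinite_pairs:
  fixes A :: "nat set"
  assumes "infinite A"
    and "liminf (\<lambda>n. ereal (real (enumerate A (Suc n)) - real (enumerate A n))) < \<infinity>"
  obtains d where "d > 0" "infinite {b \<in> A. b + d \<in> A}"
proof -
  define gap where "gap n = enumerate A (Suc n) - enumerate A n" for n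
  have less: "enumerate A n < enumerate A (Suc n)" for n
    using assms(1) by (simp add: enumerate_step)
  then have gap: "real (enumerate A (Suc n)) - real (enumerate A n) = real (gap n)" for n
    by (simp add: gap_def of_nat_diff less_imp_le)
  obtain C :: ereal where C: "liminf (\<lambda>n. ereal (real (gap n))) < C" "C < \<infinity>"
    using dense[OF assms(2)] unfolding gap by blast
  have "\<not> (\<forall>\<^sub>F n in sequentially. C \<le> ereal (real (gap n)))"
    using Liminf_bounded[of C "\<lambda>n. ereal (real (gap n))" sequentially] C(1) by auto
  then have freq: "infinite {n. ereal (real (gap n)) < C}"
    by (auto simp: eventually_sequentially infinite_nat_iff_unbounded_le not_le)
  obtain K where K: "C \<le> ereal (real K)"
    using C(2) by (cases C) (use real_arch_simple in auto)
  have "gap ` {n. ereal (real (gap n)) < C} \<subseteq> {..K}"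
    using K by (auto dest: less_le_trans)
  then have "finite (gap ` {n. ereal (real (gap n)) < C})" by (rule finite_subset) simp
  then obtain n0 where n0: "infinite {n \<in> {n. ereal (real (gap n)) < C}. gap n = gap n0}"
    using pigeonhole_infinite[OF freq] by blast
  show thesis
  proof
    show "gap n0 > 0" using less by (simp add: gap_def)
    have "enumerate A ` {n. gap n = gap n0} \<subseteq> {b \<in> A. b + gap n0 \<in> A}"
    proof safe
      fix n assume n: "gap n = gap n0"
      show "enumerate A n \<in> A" using assms(1) by (rule enumerate_in_set)
      have "enumerate A n + gap n0 = enumerate A (Suc n)"
        using less[of n] n gap_def[of n] by linarith
      then show "enumerate A n + gap n0 \<in> A" using enumerate_in_set[OF assms(1)] by metis
    qed
    moreover have "infinite {n. gap n = gap n0}"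
      using n0 by (rule infinite_super[rotated]) auto
    then have "infinite (enumerate A ` {n. gap n = gap n0})"
      using assms(1) by (subst finite_image_iff)
        (auto intro!: inj_on_subset[OF strict_mono_imp_inj_on] strict_mono_enumerate)
    ultimately show "infinite {b \<in> A. b + gap n0 \<in> A}" by (rule infinite_super)
  qed
qed

section \<open>Density in geometric blocks\<close>

definition block :: "real \<Rightarrow> nat set \<Rightarrow> nat \<Rightarrow> nat set" where
  "block \<rho> A k = {a \<in> A. real a \<in> {\<rho> ^ k <.. \<rho> ^ (k + 1)}}"

lemma finite_block: "finite (block \<rho> A k)"
proof (rule finite_subset)
  show "block \<rho> A k \<subseteq> {..nat \<lfloor>\<rho> ^ (k + 1)\<rfloor>}"
    by (auto simp: block_def le_nat_floor)
qed simp

text \<open>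
  The weight \<^term>\<open>w j\<close> is a lower bound for the elements of block \<^term>\<open>j\<close>. Since weights
  increase, each element of \<^term>\<open>X\<close> costs at most the last one. Keeping \<^term>\<open>w\<close> abstract leaves
  room for the improved weight \<^term>\<open>2 ^ j + 1 :: real\<close> when \<^term>\<open>\<rho> = 2\<close>.
\<close>

lemma sum_blocks_lower_bound:
  fixes \<rho> r :: real and w :: "nat \<Rightarrow> real"
  assumes "\<rho> > 1" "mono w" "w 0 \<ge> 0" and "finite X"
    and w: "\<And>j a. real a > \<rho> ^ j \<Longrightarrow> w j \<le> real a"
    and blocks: "\<And>k. k \<ge> j0 \<Longrightarrow> real (card (block \<rho> A k)) \<ge> r"
    and "j0 \<le> m"
  shows "r * (\<Sum>j=j0..m. w j) - real (card X) * w m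
           \<le> real (\<Sum>((\<Union>j\<in>{j0..m}. block \<rho> A j) - X))"
proof -
  let ?U = "\<lambda>m. \<Union>j\<in>{j0..m}. block \<rho> A j"
  have w0: "0 \<le> w j" for j using \<open>mono w\<close> \<open>w 0 \<ge> 0\<close> by (meson le0 monoD order_trans)
  have one: "(r - real (card (X \<inter> block \<rho> A j))) * w j \<le> real (\<Sum>(block \<rho> A j - X))"
    if "j \<ge> j0" for j
  proof -
    have "r - real (card (X \<inter> block \<rho> A j)) \<le> real (card (block \<rho> A j - X))"
    proof -
      have "card (block \<rho> A j) = card (block \<rho> A j - X) + card (X \<inter> block \<rho> A j)"
        using card_Diff_subset_Int[of "block \<rho> A j" X] finite_block[of \<rho> A j]
          card_mono[of "block \<rho> A j" "block \<rho> A j \<inter> X"]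
        by (simp add: Int_commute)
      then show ?thesis using blocks[OF that] by simp
    qed
    then have "(r - real (card (X \<inter> block \<rho> A j))) * w j \<le> real (card (block \<rho> A j - X)) * w j"
      using w0 by (rule mult_right_mono)
    also have "\<dots> \<le> (\<Sum>a\<in>block \<rho> A j - X. real a)"
      by (rule sum_bounded_below) (auto simp: block_def intro: w)
    finally show ?thesis by simp
  qed
  have "r * (\<Sum>j=j0..m. w j) - real (card (X \<inter> ?U m)) * w m \<le> real (\<Sum>(?U m - X))"
    using \<open>j0 \<le> m\<close>
  proof (induction m rule: dec_induct)
    case base
    then show ?case using one[of j0] by (simp add: algebra_simps)
  next
    case (step m)
    have U: "?U (Suc m) = ?U m \<union> block \<rho> A (Suc m)"
      using step by (auto simp: atLeastAtMostSuc_conv)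
    have disj: "?U m \<inter> block \<rho> A (Suc m) = {}"
    proof -
      have "real a \<le> \<rho> ^ Suc m" if "a \<in> block \<rho> A j" "j \<le> m" for a j
      proof -
        have "real a \<le> \<rho> ^ (j + 1)" using that by (simp add: block_def)
        also have "\<dots> \<le> \<rho> ^ Suc m" using that \<open>\<rho> > 1\<close> by (intro power_increasing) auto
        finally show ?thesis .
      qed
      then show ?thesis by (fastforce simp: block_def)
    qed
    have fin: "finite (?U m)" by (auto intro: finite_block)
    have c: "card (X \<inter> ?U (Suc m)) = card (X \<inter> ?U m) + card (X \<inter> block \<rho> A (Suc m))"
      unfolding U Int_Un_distrib using disj \<open>finite X\<close> by (intro card_Un_disjoint) auto
    have s: "\<Sum>(?U (Suc m) - X) = \<Sum>(?U m - X) + \<Sum>(block \<rho> A (Suc m) - X)"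
      unfolding U Un_Diff using disj fin finite_block by (intro sum.union_disjoint) auto
    have "real (card (X \<inter> ?U m)) * w m \<le> real (card (X \<inter> ?U m)) * w (Suc m)"
      using \<open>mono w\<close> by (intro mult_left_mono) (auto simp: mono_def)
    moreover have "(\<Sum>j=j0..Suc m. w j) = (\<Sum>j=j0..m. w j) + w (Suc m)"
      using step by simp
    ultimately show ?case
      using step.IH one[of "Suc m"] step.hyps unfolding c s by (simp add: algebra_simps)
  qed
  moreover have "real (card (X \<inter> ?U m)) * w m \<le> real (card X) * w m"
    using \<open>finite X\<close> w0 by (intro mult_right_mono) (auto intro: card_mono)
  ultimately show ?thesis by linarith
qed

text \<open>
  The surplus over \<^term>\<open>\<rho> * (\<rho> - 1)\<close> elements per block contributes the factor
  \<^term>\<open>(1 + of_bool (\<rho> > 2)) * \<rho> / (\<rho> - 1)\<close> to the coefficient of \<^term>\<open>\<rho> ^ m\<close>. This exceeds 2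
  unless \<^term>\<open>\<rho> = 2\<close>, where it equals 2.
\<close>

lemma geometric_sum_margin:
  fixes \<rho> r D :: real
  assumes "\<rho> > 1" "\<rho> \<noteq> 2" and r: "r \<ge> \<rho> * (\<rho> - 1) + 1 + of_bool (\<rho> > 2)"
  shows "\<forall>\<^sub>F m in sequentially. \<rho> ^ (m + 2) + D \<le> r * (\<Sum>j=j0..m. \<rho> ^ j) - 2 * \<rho> ^ m"
proof -
  define \<epsilon> where "\<epsilon> = (1 + of_bool (\<rho> > 2)) * \<rho> / (\<rho> - 1) - 2"
  have "\<epsilon> > 0" using assms(1,2) by (auto simp: \<epsilon>_def field_simps)
  define B where "B = D + r * \<rho> ^ j0 / (\<rho> - 1)"
  obtain n where n: "B / \<epsilon> < \<rho> ^ n" using real_arch_pow[OF \<open>\<rho> > 1\<close>] by blast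
  have "B \<le> \<epsilon> * \<rho> ^ m" if "m \<ge> n" for m
  proof -
    have "\<rho> ^ n \<le> \<rho> ^ m" using that \<open>\<rho> > 1\<close> by (intro power_increasing) auto
    then have "B / \<epsilon> \<le> \<rho> ^ m" using n by linarith
    then show ?thesis using \<open>\<epsilon> > 0\<close> by (simp add: field_simps)
  qed
  then have "\<forall>\<^sub>F m in sequentially. B \<le> \<epsilon> * \<rho> ^ m"
    by (auto simp: eventually_sequentially)
  then show ?thesis
    using eventually_ge_at_top[of j0]
  proof eventually_elim
    case (elim m)
    have S: "(\<Sum>j=j0..m. \<rho> ^ j) = (\<rho> ^ (m + 1) - \<rho> ^ j0) / (\<rho> - 1)"
      using sum_gp[of \<rho> j0 m] elim(2) \<open>\<rho> > 1\<close> by (simp add: field_simps)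
    have "\<rho> ^ (m + 2) + (\<epsilon> + 2) * \<rho> ^ m
        = (\<rho> * (\<rho> - 1) + 1 + of_bool (\<rho> > 2)) * (\<rho> ^ (m + 1) / (\<rho> - 1))"
      using \<open>\<rho> > 1\<close> by (simp add: \<epsilon>_def field_simps)
    also have "\<dots> \<le> r * (\<rho> ^ (m + 1) / (\<rho> - 1))"
      using r \<open>\<rho> > 1\<close> by (intro mult_right_mono) auto
    finally show ?case unfolding S using elim(1) unfolding B_def
      by (simp add: algebra_simps diff_divide_distrib)
  qed
qed

text \<open>
  The powers of 2 cancel up to a constant; the summands 1 leave a margin that grows linearly
  in \<^term>\<open>m\<close>.
\<close>

lemma dyadic_sum_margin:
  fixes r D :: real
  assumes "r \<ge> 3"
  shows "\<forall>\<^sub>F m in sequentially. 2 ^ (m + 2) + D \<le> r * (\<Sum>j=j0..m. 2 ^ j + 1) - 2 * (2 ^ m + 1)"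
proof -
  have "\<forall>\<^sub>F m in sequentially. D + 3 * 2 ^ j0 + 3 * real j0 \<le> real m"
    using filterlim_real_sequentially by (simp add: filterlim_at_top)
  then show ?thesis
    using eventually_ge_at_top[of j0]
  proof eventually_elim
    case (elim m)
    have "(\<Sum>j=j0..m. 2 ^ j) = (2 ^ (m + 1) - 2 ^ j0 :: real)"
      using sum_gp[of "2::real" j0 m] elim(2) by simp
    then have S: "(\<Sum>j=j0..m. 2 ^ j + 1 :: real) = 2 ^ (m + 1) - 2 ^ j0 + (real m + 1 - real j0)"
      using elim(2) by (simp add: sum.distrib of_nat_diff)
    have "3 * (\<Sum>j=j0..m. 2 ^ j + 1) \<le> r * (\<Sum>j=j0..m. 2 ^ j + 1)"
      using assms by (intro mult_right_mono sum_nonneg) auto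
    then show ?case using elim(1) unfolding S by simp
  qed
qed

text \<open>
  If \<^term>\<open>\<rho> ^ (m + 1) < real c\<close> and \<^term>\<open>real c \<le> \<rho> ^ (m + 2)\<close>, then all blocks up to
  \<^term>\<open>m\<close> lie below \<^term>\<open>c\<close>, and the margin estimates apply to their sum.
\<close>

lemma dense_blocks_imp_pair_robust:
  fixes \<rho> r :: real
  assumes "\<rho> > 1" and r: "r \<ge> \<rho> * (\<rho> - 1) + 1 + of_bool (\<rho> > 2)"
    and blocks: "\<forall>\<^sub>F k in sequentially. real (card (block \<rho> A k)) \<ge> r"
  shows "pair_robust A"
  unfolding pair_robust_def
proof
  fix D
  obtain j0 where j0: "\<And>k. k \<ge> j0 \<Longrightarrow> real (card (block \<rho> A k)) \<ge> r"
    using blocks by (auto simp: eventually_sequentially)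
  define w :: "nat \<Rightarrow> real" where "w j = \<rho> ^ j + of_bool (\<rho> = 2)" for j
  have w: "w j \<le> real a" if "real a > \<rho> ^ j" for j a
  proof (cases "\<rho> = 2")
    case True
    then have "2 ^ j < a" using that by (metis of_nat_less_iff of_nat_numeral of_nat_power)
    then have "real (2 ^ j + 1) \<le> real a" by (subst of_nat_le_iff) simp
    then show ?thesis using True by (simp add: w_def)
  qed (use that in \<open>simp add: w_def\<close>)
  have "mono w" using \<open>\<rho> > 1\<close> by (auto simp: mono_def w_def intro!: power_increasing)
  have "w 0 \<ge> 0" by (simp add: w_def)
  have "\<forall>\<^sub>F m in sequentially. \<rho> ^ (m + 2) + real D \<le> r * (\<Sum>j=j0..m. w j) - 2 * w m"
  proof (cases "\<rho> = 2")
    case True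
    then show ?thesis using dyadic_sum_margin[of r "real D" j0] r by (simp add: w_def)
  next
    case False
    then show ?thesis using geometric_sum_margin[OF \<open>\<rho> > 1\<close> False r] by (simp add: w_def)
  qed
  then obtain m0 where m0: "\<And>m. m \<ge> m0 \<Longrightarrow>
      \<rho> ^ (m + 2) + real D \<le> r * (\<Sum>j=j0..m. w j) - 2 * w m"
    by (auto simp: eventually_sequentially)
  define M where "M = max j0 m0"
  have "c + D \<le> \<Sum>{a \<in> A - {x, y}. a < c}" if c: "c \<ge> nat \<lceil>\<rho> ^ (M + 1)\<rceil> + 1" for c x y
  proof -
    have "\<rho> ^ (M + 1) < real c" using c by linarith
    moreover obtain n where n: "real c < \<rho> ^ n"
      using real_arch_pow[OF \<open>\<rho> > 1\<close>] by blast
    ultimately obtain m where m: "m \<ge> M" "\<rho> ^ (m + 1) < real c" "real c \<le> \<rho> ^ (m + 2)"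
    proof -
      define k where "k = (LEAST k. real c \<le> \<rho> ^ k)"
      have k: "real c \<le> \<rho> ^ k" unfolding k_def by (rule LeastI[of _ n]) (use n in simp)
      have "k > M + 1"
      proof (rule ccontr)
        assume "\<not> k > M + 1"
        then have "\<rho> ^ k \<le> \<rho> ^ (M + 1)" using \<open>\<rho> > 1\<close> by (intro power_increasing) auto
        then show False using k \<open>\<rho> ^ (M + 1) < real c\<close> by linarith
      qed
      moreover have "\<not> real c \<le> \<rho> ^ (k - 1)"
        using not_less_Least[of "k - 1" "\<lambda>k. real c \<le> \<rho> ^ k"] \<open>k > M + 1\<close>
        unfolding k_def by auto
      ultimately show thesis using k
        by (intro that[of "k - 2"]) (auto simp: numeral_2_eq_2 Suc_diff_Suc)
    qed
    have wm: "0 \<le> w m" using \<open>\<rho> > 1\<close> by (simp add: w_def)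
    have "card {x, y} \<le> 2" by (simp add: card_insert_if)
    then have "real (card {x, y}) * w m \<le> 2 * w m" using wm by (intro mult_right_mono) auto
    then have "real c + real D \<le> r * (\<Sum>j=j0..m. w j) - real (card {x, y}) * w m"
      using m0[of m] m by (auto simp: M_def)
    also have "\<dots> \<le> real (\<Sum>((\<Union>j\<in>{j0..m}. block \<rho> A j) - {x, y}))"
      using m by (intro sum_blocks_lower_bound[OF \<open>\<rho> > 1\<close> \<open>mono w\<close> \<open>w 0 \<ge> 0\<close> _ w j0])
        (auto simp: M_def)
    finally have "c + D \<le> \<Sum>((\<Union>j\<in>{j0..m}. block \<rho> A j) - {x, y})" by linarith
    also have "\<dots> \<le> \<Sum>{a \<in> A - {x, y}. a < c}"
    proof (rule sum_mono2)
      have "a < c" if "a \<in> block \<rho> A j" "j \<le> m" for a j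
      proof -
        have "real a \<le> \<rho> ^ (j + 1)" using that by (simp add: block_def)
        also have "\<dots> \<le> \<rho> ^ (m + 1)" using that \<open>\<rho> > 1\<close> by (intro power_increasing) auto
        finally show ?thesis using m by linarith
      qed
      then show "(\<Union>j\<in>{j0..m}. block \<rho> A j) - {x, y} \<subseteq> {a \<in> A - {x, y}. a < c}"
        by (auto simp: block_def)
    qed auto
    finally show ?thesis .
  qed
  then show "\<exists>N. \<forall>c\<ge>N. \<forall>x y. c + D \<le> \<Sum>{a \<in> A - {x, y}. a < c}" by blast
qed

section \<open>Strong completeness\<close>

theorem corollary6p3:
  fixes \<rho> :: real and A :: "nat set"
  assumes "\<rho> > 1"
    and "A \<subseteq> {1..}"
    and "\<forall>\<^sub>F k::nat in sequentially.
           int (card {a \<in> A. real a \<in> {\<rho> ^ k <.. \<rho> ^ (k + 1)}}) \<ge> u_rho \<rho> + 1 + of_bool (\<rho> > 2)"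
    and "\<And>N::nat. N \<ge> 1 \<Longrightarrow> Gcd (A \<inter> {N..}) = 1"
    and "liminf (\<lambda>n. ereal (real (enumerate A (Suc n)) - real (enumerate A n))) < \<infinity>"
  shows "strongly_sum_complete A"
proof -
  define r :: real where "r = real_of_int (u_rho \<rho> + 1 + of_bool (\<rho> > 2))"
  have "pair_robust A"
  proof (rule dense_blocks_imp_pair_robust[OF \<open>\<rho> > 1\<close>])
    show "r \<ge> \<rho> * (\<rho> - 1) + 1 + of_bool (\<rho> > 2)"
      by (simp add: r_def u_rho_def)
    show "\<forall>\<^sub>F k in sequentially. real (card (block \<rho> A k)) \<ge> r"
      using assms(3)
    proof eventually_elim
      case (elim k)
      then have "real_of_int (int (card (block \<rho> A k))) \<ge> r"
        unfolding r_def block_def by (subst of_int_le_iff)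
      then show ?case by simp
    qed
  qed
  moreover obtain d where "d > 0" "infinite {b \<in> A. b + d \<in> A}"
    using liminf_gap_imp_infinite_pairs[OF pair_robust_imp_infinite[OF \<open>pair_robust A\<close>] assms(5)]
    by blast
  ultimately show ?thesis
    using assms(4) by (intro pair_robust_imp_strongly_sum_complete)
qed

end
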